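(* Let $d>1$ be an integer and let $\mathbf{K}$ be an $\mathbf{o}$-symmetric convex body in $\mathbb{R}^d$. Let $r\geq\frac{\lambda}{2}>0$, let $N\geq 2^d$ be an integer, and let $Q=\{\mathbf{q}_1,\dots,\mathbf{q}_N\}\subset\mathbb{R}^d$ be a uniform contraction of $P=\{\mathbf{p}_1,\dots,\mathbf{p}_N\}\subset\mathbb{R}^d$ with separating value $\lambda$ in $\mathbb{M}^d_{\mathbf{K}}$. Then $$V_d\left(\mathrm{conv}(Q_r^{\mathbf{K}})\right)\leq V_d\left(\mathrm{conv}(P_r^{\mathbf{K}})\right).$$
   Context: An $\mathbf{o}$-symmetric convex body $\mathbf{K}\subset\mathbb{R}^d$ is a compact convex set with nonempty interior that is symmetric about the origin $\mathbf{o}$. It generates the norm $\|\mathbf{x}\|_{\mathbf{K}}:=\min\{\mu\geq 0 \mid \mathbf{x}\in\mu\mathbf{K}\}$, and $\mathbb{M}^d_{\mathbf{K}}$ denotes $\mathbb{R}^d$ equipped with this norm. For $\mathbf{x}\in\mathbb{R}^d$ and $r>0$, $B_{\mathbf{K}}[\mathbf{x},r]:=\mathbf{x}+r\mathbf{K}$. For $X\subseteq\mathbb{R}^d$ and $r>0$, $X_r^{\mathbf{K}}:=\bigcup\{B_{\mathbf{K}}[\mathbf{x},r]\mid \mathbf{x}\in X\}$. The labeled point set $Q=\{\mathbf{q}_1,\dots,\mathbf{q}_N\}$ is a uniform contraction of the labeled point set $P=\{\mathbf{p}_1,\dots,\mathbf{p}_N\}$ with separating value $\lambda>0$ in $\mathbb{M}^d_{\mathbf{K}}$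 if $\|\mathbf{q}_i-\mathbf{q}_j\|_{\mathbf{K}}\leq\lambda\leq\|\mathbf{p}_i-\mathbf{p}_j\|_{\mathbf{K}}$ for all $1\leq i<j\leq N$. $V_d(\cdot)$ is Lebesgue measure in $\mathbb{R}^d$ and $\mathrm{conv}(\cdot)$ is the convex hull. *)

theory Defs
  imports "HOL-Analysis.Analysis"
begin

definition o_symmetric_convex_body :: "(real ^ 'n) set \<Rightarrow> bool" where
  "o_symmetric_convex_body K \<longleftrightarrow>
     compact K \<and> convex K \<and> interior K \<noteq> {} \<and> (\<forall>x\<in>K. - x \<in> K)"

(* LEAST is the minimum in the definition of the norm; it is attained for the
   bodies above because K is compact and contains a neighbourhood of 0. *)
definition norm_K :: "(real ^ 'n) set \<Rightarrow> real ^ 'n \<Rightarrow> real" where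
  "norm_K K x = (LEAST \<mu>. 0 \<le> \<mu> \<and> x \<in> (\<lambda>y. \<mu> *\<^sub>R y) ` K)"

definition ball_K :: "(real ^ 'n) set \<Rightarrow> real ^ 'n \<Rightarrow> real \<Rightarrow> (real ^ 'n) set" where
  "ball_K K x r = (\<lambda>y. x + r *\<^sub>R y) ` K"

definition neighbourhood_K :: "(real ^ 'n) set \<Rightarrow> real \<Rightarrow> (real ^ 'n) set \<Rightarrow> (real ^ 'n) set" where
  "neighbourhood_K K r X = (\<Union>x\<in>X. ball_K K x r)"

(* A labeled set of N points is a map q restricted to the labels {1..N};
   points with different labels may coincide. *)
definition uniform_contraction ::
  "(real ^ 'n) set \<Rightarrow> nat \<Rightarrow> real \<Rightarrow> (nat \<Rightarrow> real ^ 'n) \<Rightarrow> (nat \<Rightarrow> real ^ 'n) \<Rightarrow> bool" where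
  "uniform_contraction K N lam q p \<longleftrightarrow>
     lam > 0 \<and>
     (\<forall>i j. 1 \<le> i \<and> i < j \<and> j \<le> N \<longrightarrow>
        norm_K K (q i - q j) \<le> lam \<and> lam \<le> norm_K K (p i - p j))"

end

theory Submission
  imports Defs "HOL-Probability.Distribution_Functions"
begin

text \<open>
  Both volumes are compared with that of a ball of radius \<open>r + lam / 2\<close> in the norm of \<open>K\<close>.
  Write \<open>V\<close> for the volume and \<open>d\<close> for the dimension.

  The hull of the neighbourhood of \<open>Q\<close> has diameter at most \<open>lam + 2 r\<close>. By the isodiametric
  inequality in the norm of \<open>K\<close> (\<open>isodiametric_inequality\<close>) its volume is at most
  \<open>(r + lam / 2) ^ d * V K\<close>.

  The points of \<open>P\<close> are at mutual distance at least \<open>lam\<close>, so the balls of radius \<open>lam / 2\<close> about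
  them do not overlap (\<open>measure_separated_neighbourhood\<close>). Their hull \<open>C\<close> therefore has volume at
  least \<open>N * (lam / 2) ^ d * V K \<ge> lam ^ d * V K\<close>, because \<open>N \<ge> 2 ^ d\<close>. The hull of the
  neighbourhood of \<open>P\<close> contains \<open>C + (r - lam / 2) K\<close>, and the Brunn--Minkowski inequality bounds
  the \<open>d\<close>-th root of the volume of this sum below by \<open>lam + (r - lam / 2) = r + lam / 2\<close> times the
  \<open>d\<close>-th root of \<open>V K\<close>.

  Both halves rest on the Brunn--Minkowski inequality for bounded convex sets
  (\<open>brunn_minkowski_convex\<close>), which is proved by the method of Hadwiger and Ohmann. For two boxes it is
  the inequality between arithmetic and geometric means. For finite disjoint unions of boxes it
  follows by cutting both unions with parallel hyperplanes in the same proportion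
  (\<open>brunn_minkowski_box_packing_step\<close>). Open sets are exhausted by such unions, and convex sets have
  the volume of their interiors.
\<close>

section \<open>A reverse triangle inequality for geometric means\<close>

text \<open>
  The inequality of arithmetic and geometric means, cleared of roots. With the mean \<open>m\<close>
  normalised away, \<open>1 + y \<le> exp y\<close> at \<open>y = x i / m - 1\<close> bounds each factor, and these
  exponents add up to 0.
\<close>

lemma prod_le_mean_power:
  fixes x :: "'i \<Rightarrow> real"
  assumes "finite I" "I \<noteq> {}" and nonneg: "\<And>i. i \<in> I \<Longrightarrow> 0 \<le> x i"
  shows "prod x I \<le> (sum x I / card I) ^ card I"
proof (cases "sum x I = 0")
  case True
  then have "\<And>i. i \<in> I \<Longrightarrow> x i = 0"
    using assms by (simp add: sum_nonneg_eq_0_iff)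
  then have "prod x I = 0" using assms by auto
  then show ?thesis using True by simp
next
  case False
  define m where "m = sum x I / card I"
  have n: "card I > 0" using assms by (simp add: card_gt_0_iff)
  have m: "m > 0"
    using False assms n unfolding m_def
    by (metis divide_pos_pos of_nat_0_less_iff order_le_less sum_nonneg)
  have "(\<Prod>i\<in>I. x i / m) \<le> (\<Prod>i\<in>I. exp (x i / m - 1))"
  proof (rule prod_mono)
    fix i assume "i \<in> I"
    have "1 + (x i / m - 1) \<le> exp (x i / m - 1)" by (rule exp_ge_add_one_self)
    then show "0 \<le> x i / m \<and> x i / m \<le> exp (x i / m - 1)"
      using nonneg[OF \<open>i \<in> I\<close>] m by simp
  qed
  also have "\<dots> = exp (\<Sum>i\<in>I. x i / m - 1)"
    using assms(1) by (simp add: exp_sum)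
  also have "(\<Sum>i\<in>I. x i / m - 1) = sum x I / m - card I"
    by (simp add: sum_subtractf sum_divide_distrib)
  also have "\<dots> = 0"
    using m n False by (simp add: m_def)
  finally have "prod x I / m ^ card I \<le> 1"
    by (simp add: prod_dividef)
  then show ?thesis
    using m by (simp add: m_def[symmetric] field_simps)
qed

text \<open>
  Dividing by the right-hand side turns the two summands into the geometric means of the ratios
  \<open>u i / (u i + v i)\<close> and \<open>v i / (u i + v i)\<close>. The corresponding arithmetic means add up to 1.
\<close>

lemma root_prod_add_le:
  fixes u v :: "'i \<Rightarrow> real"
  assumes I: "finite I" "I \<noteq> {}"
    and u: "\<And>i. i \<in> I \<Longrightarrow> 0 < u i" and v: "\<And>i. i \<in> I \<Longrightarrow> 0 < v i"
  shows "root (card I) (prod u I) + root (card I) (prod v I)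
       \<le> root (card I) (\<Prod>i\<in>I. u i + v i)"
proof -
  let ?n = "card I" and ?w = "\<lambda>i. u i + v i"
  have n: "?n > 0" using I by (simp add: card_gt_0_iff)
  have w: "prod ?w I > 0"
    using u v by (intro prod_pos) (auto intro: add_pos_pos)
  have *: "root ?n (prod f I) \<le> root ?n (prod ?w I) * ((\<Sum>i\<in>I. f i / ?w i) / ?n)"
    if f: "\<And>i. i \<in> I \<Longrightarrow> 0 < f i" for f
  proof -
    have q: "0 \<le> f i / ?w i" if "i \<in> I" for i
      using f[OF that] u[OF that] v[OF that] by simp
    have "prod f I / prod ?w I = (\<Prod>i\<in>I. f i / ?w i)"
      by (simp add: prod_dividef)
    also have "\<dots> \<le> ((\<Sum>i\<in>I. f i / ?w i) / ?n) ^ ?n"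
      by (rule prod_le_mean_power[OF I q])
    finally have "root ?n (prod f I / prod ?w I) \<le> root ?n (((\<Sum>i\<in>I. f i / ?w i) / ?n) ^ ?n)"
      using n by simp
    also have "\<dots> = (\<Sum>i\<in>I. f i / ?w i) / ?n"
    proof -
      have "0 \<le> (\<Sum>i\<in>I. f i / ?w i)" using q by (rule sum_nonneg)
      then show ?thesis using n by (simp add: real_root_power_cancel)
    qed
    finally have "root ?n (prod f I) / root ?n (prod ?w I) \<le> (\<Sum>i\<in>I. f i / ?w i) / ?n"
      by (simp only: real_root_divide)
    moreover have "root ?n (prod ?w I) > 0" using w n by simp
    ultimately show ?thesis by (simp only: pos_divide_le_eq mult.commute)
  qed
  have "(\<Sum>i\<in>I. u i / ?w i) + (\<Sum>i\<in>I. v i / ?w i) = (\<Sum>i\<in>I. 1)"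
    unfolding sum.distrib[symmetric]
  proof (rule sum.cong)
    fix i assume "i \<in> I"
    then have "?w i \<noteq> 0" using u[of i] v[of i] by linarith
    then show "u i / ?w i + v i / ?w i = 1" by (simp add: add_divide_distrib[symmetric])
  qed simp
  then have one: "(\<Sum>i\<in>I. u i / ?w i) / ?n + (\<Sum>i\<in>I. v i / ?w i) / ?n = 1"
    using n by (simp add: add_divide_distrib[symmetric])
  have "root ?n (prod u I) + root ?n (prod v I)
      \<le> root ?n (prod ?w I) * ((\<Sum>i\<in>I. u i / ?w i) / ?n)
        + root ?n (prod ?w I) * ((\<Sum>i\<in>I. v i / ?w i) / ?n)"
    using u v by (intro add_mono *)
  also have "\<dots> = root ?n (prod ?w I)"
    unfolding distrib_left[symmetric] one by simp
  finally show ?thesis .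
qed

section \<open>The Brunn--Minkowski inequality for boxes\<close>

abbreviation root_volume :: "'a::euclidean_space set \<Rightarrow> real" where
  "root_volume A \<equiv> root DIM('a) (measure lebesgue A)"

definition brunn_minkowski :: "'a::euclidean_space set \<Rightarrow> 'a set \<Rightarrow> bool" where
  "brunn_minkowski A B \<longleftrightarrow>
     root_volume A + root_volume B \<le> root_volume (A + B)"

lemma brunn_minkowski_commute: "brunn_minkowski A B \<longleftrightarrow> brunn_minkowski B A"
  by (simp add: brunn_minkowski_def add.commute)

lemma open_set_plus:
  fixes A B :: "'a::real_normed_vector set"
  assumes "open A" shows "open (A + B)"
proof -
  have "A + B = (\<Union>x\<in>A. \<Union>y\<in>B. {x + y})" by (auto simp: set_plus_def)
  then show ?thesis using open_sums[of A B] assms by simp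
qed

lemma bounded_set_plus:
  fixes A B :: "'a::real_normed_vector set"
  assumes "bounded A" "bounded B" shows "bounded (A + B)"
proof -
  have "A + B = (\<Union>x\<in>A. \<Union>y\<in>B. {x + y})" by (auto simp: set_plus_def)
  then show ?thesis using bounded_sums[of A B] assms by simp
qed

text \<open>
  The sum of two boxes contains the box whose side lengths are the sums of theirs, so for boxes
  Brunn--Minkowski is the inequality \<open>root_prod_add_le\<close> for the side lengths.
\<close>

lemma brunn_minkowski_box:
  fixes a b c d :: "'a::euclidean_space"
  assumes "box a b \<noteq> {}" "box c d \<noteq> {}"
  shows "brunn_minkowski (box a b) (box c d)"
proof -
  have ab: "a \<bullet> i < b \<bullet> i" and cd: "c \<bullet> i < d \<bullet> i" if "i \<in> Basis" for i
    using assms that by (auto simp: box_ne_empty)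
  have sub: "box (a + c) (b + d) \<subseteq> box a b + box c d"
  proof
    fix x assume x: "x \<in> box (a + c) (b + d)"
    \<comment> \<open>Divide each coordinate of the point in the ratio of the two side lengths.\<close>
    define t where "t i = (x \<bullet> i - a \<bullet> i - c \<bullet> i) / (b \<bullet> i - a \<bullet> i + (d \<bullet> i - c \<bullet> i))" for i
    define y where "y = (\<Sum>i\<in>Basis. (a \<bullet> i + t i * (b \<bullet> i - a \<bullet> i)) *\<^sub>R i)"
    have t: "0 < t i \<and> t i < 1" if "i \<in> Basis" for i
      using ab[OF that] cd[OF that] x that by (auto simp: t_def mem_box inner_add_left field_simps)
    have "y \<in> box a b"
      unfolding mem_box
    proof
      fix i :: 'a assume i: "i \<in> Basis"
      have "t i * (b \<bullet> i - a \<bullet> i) > 0" "t i * (b \<bullet> i - a \<bullet> i) < 1 * (b \<bullet> i - a \<bullet> i)"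
        using t[OF i] ab[OF i] by (auto intro!: mult_strict_right_mono)
      then show "a \<bullet> i < y \<bullet> i \<and> y \<bullet> i < b \<bullet> i" using i by (simp add: y_def)
    qed
    moreover have "x - y \<in> box c d"
      unfolding mem_box
    proof
      fix i :: 'a assume i: "i \<in> Basis"
      have "t i * (b \<bullet> i - a \<bullet> i + (d \<bullet> i - c \<bullet> i)) = x \<bullet> i - a \<bullet> i - c \<bullet> i"
        using ab[OF i] cd[OF i] by (simp add: t_def)
      then have "(x - y) \<bullet> i = c \<bullet> i + t i * (d \<bullet> i - c \<bullet> i)"
        by (simp add: inner_diff_left y_def i) (simp add: algebra_simps)
      moreover have "t i * (d \<bullet> i - c \<bullet> i) > 0" "t i * (d \<bullet> i - c \<bullet> i) < 1 * (d \<bullet> i - c \<bullet> i)"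
        using t[OF i] cd[OF i] by (auto intro!: mult_strict_right_mono)
      ultimately show "c \<bullet> i < (x - y) \<bullet> i \<and> (x - y) \<bullet> i < d \<bullet> i" by simp
    qed
    ultimately show "x \<in> box a b + box c d"
      by (metis add.commute diff_add_cancel set_plus_intro)
  qed
  have meas: "box a b + box c d \<in> lmeasurable"
    by (intro lmeasurable_open open_set_plus bounded_set_plus) auto
  have vol: "measure lebesgue (box a b) = (\<Prod>i\<in>Basis. (b - a) \<bullet> i)"
    if "\<And>i. i \<in> Basis \<Longrightarrow> a \<bullet> i < b \<bullet> i" for a b :: 'a
    using that by (simp add: measure_lborel_box_eq less_imp_le)
  have "root DIM('a) (measure lebesgue (box a b)) + root DIM('a) (measure lebesgue (box c d))
      \<le> root DIM('a) (\<Prod>i\<in>Basis. (b - a) \<bullet> i + (d - c) \<bullet> i)"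
    proof -
    have "measure lebesgue (box a b) = (\<Prod>i\<in>Basis. (b - a) \<bullet> i)"
      by (rule vol) (rule ab)
    moreover have "measure lebesgue (box c d) = (\<Prod>i\<in>Basis. (d - c) \<bullet> i)"
      by (rule vol) (rule cd)
    moreover have "0 < (b - a) \<bullet> i" "0 < (d - c) \<bullet> i" if "i \<in> Basis" for i
      using ab[OF that] cd[OF that] by (simp_all add: inner_diff_left)
    ultimately show ?thesis
      using root_prod_add_le[of Basis "\<lambda>i. (b - a) \<bullet> i" "\<lambda>i. (d - c) \<bullet> i"]
      by (simp only: finite_Basis nonempty_Basis not_False_eq_True)
  qed
  also have "\<dots> = root DIM('a) (measure lebesgue (box (a + c) (b + d)))"
    proof -
    have "(a + c) \<bullet> i < (b + d) \<bullet> i" if "i \<in> Basis" for i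
      using ab[OF that] cd[OF that] by (simp add: inner_add_left)
    then have "measure lebesgue (box (a + c) (b + d)) = (\<Prod>i\<in>Basis. ((b + d) - (a + c)) \<bullet> i)"
      by (rule vol)
    also have "\<dots> = (\<Prod>i\<in>Basis. (b - a) \<bullet> i + (d - c) \<bullet> i)"
      by (simp only: add_diff_add inner_add_left)
    finally show ?thesis by (simp only:)
  qed
  also have "\<dots> \<le> root DIM('a) (measure lebesgue (box a b + box c d))"
    using measure_mono_fmeasurable[OF sub _ meas] by simp
  finally show ?thesis by (simp add: brunn_minkowski_def)
qed

section \<open>The Brunn--Minkowski inequality for packings of boxes\<close>

text \<open>
  Open boxes, rather than closed or half-open ones, make disjointness literal and give every
  nonempty member positive volume; the hyperplanes along which packings are cut then have to be
  discarded, which costs no volume.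
\<close>

definition box_packing :: "'a::euclidean_space set set \<Rightarrow> bool" where
  "box_packing \<D> \<longleftrightarrow>
     finite \<D> \<and> pairwise disjnt \<D> \<and> (\<forall>X\<in>\<D>. X \<noteq> {} \<and> (\<exists>a b. X = box a b))"

lemma box_Int_halfspace:
  fixes a b :: "'a::euclidean_space"
  assumes k: "k \<in> Basis"
  shows "\<exists>u v. box a b \<inter> {x. x \<bullet> k < c} = box u v"
    and "\<exists>u v. box a b \<inter> {x. c < x \<bullet> k} = box u v"
proof -
  let ?m = "\<lambda>a t. a + (t - a \<bullet> k) *\<^sub>R k"
  have m: "?m a t \<bullet> i = (if i = k then t else a \<bullet> i)" if "i \<in> Basis" for a i :: 'a and t
    using k that by (simp add: inner_add_left inner_Basis)
  have "box a b \<inter> {x. x \<bullet> k < c} = box a (?m b (min (b \<bullet> k) c))"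
    using k by (auto simp: mem_box m) (metis min_less_iff_conj)+
  then show "\<exists>u v. box a b \<inter> {x. x \<bullet> k < c} = box u v" by blast
  have "box a b \<inter> {x. c < x \<bullet> k} = box (?m a (max (a \<bullet> k) c)) b"
    using k by (auto simp: mem_box m) (metis max_less_iff_conj)+
  then show "\<exists>u v. box a b \<inter> {x. c < x \<bullet> k} = box u v" by blast
qed

definition cut :: "'a set set \<Rightarrow> 'a set \<Rightarrow> 'a set set" where
  "cut \<D> H = (\<lambda>X. X \<inter> H) ` \<D> - {{}}"

lemma Union_cut: "\<Union>(cut \<D> H) = \<Union>\<D> \<inter> H"
  by (auto simp: cut_def)

lemma card_cut_le:
  assumes "finite \<D>" shows "card (cut \<D> H) \<le> card \<D>"
proof -
  have "card (cut \<D> H) \<le> card ((\<lambda>X. X \<inter> H) ` \<D>)"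
    unfolding cut_def using assms by (intro card_mono) auto
  also have "\<dots> \<le> card \<D>" using assms by (rule card_image_le)
  finally show ?thesis .
qed

lemma card_cut_less:
  assumes "finite \<D>" "X \<in> \<D>" "X \<inter> H = {}" shows "card (cut \<D> H) < card \<D>"
proof -
  have "cut \<D> H \<subseteq> cut (\<D> - {X}) H" using assms by (auto simp: cut_def)
  then have "card (cut \<D> H) \<le> card (cut (\<D> - {X}) H)"
    using assms by (intro card_mono) (auto simp: cut_def)
  also have "\<dots> \<le> card (\<D> - {X})" using assms by (intro card_cut_le) auto
  also have "\<dots> < card \<D>" using assms by (intro card_Diff1_less)
  finally show ?thesis .
qed

lemma box_packing_cut:
  assumes D: "box_packing \<D>" and H: "\<And>a b. \<exists>u v. box a b \<inter> H = box u v"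
  shows "box_packing (cut \<D> H)"
  unfolding box_packing_def
proof (intro conjI ballI)
  show "finite (cut \<D> H)" using D by (simp add: cut_def box_packing_def)
  show "pairwise disjnt (cut \<D> H)"
    using D by (auto simp: cut_def box_packing_def pairwise_def disjnt_def)
  fix X assume X: "X \<in> cut \<D> H"
  then show "X \<noteq> {}" by (simp add: cut_def)
  from X obtain Y where "Y \<in> \<D>" "X = Y \<inter> H" by (auto simp: cut_def)
  then show "\<exists>a b. X = box a b" using D H by (metis box_packing_def)
qed

lemma box_packing_open: "box_packing \<D> \<Longrightarrow> open (\<Union>\<D>)"
  by (metis box_packing_def open_Union open_box)

lemma box_packing_bounded: "box_packing \<D> \<Longrightarrow> bounded (\<Union>\<D>)"
  unfolding box_packing_def by (metis bounded_Union bounded_box)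

lemma measure_open_pos:
  fixes S :: "'a::euclidean_space set"
  assumes "open S" "bounded S" "S \<noteq> {}" shows "0 < measure lebesgue S"
proof -
  have "\<not> negligible S" using assms by (simp add: open_not_negligible)
  then have "measure lebesgue S \<noteq> 0"
    using assms negligible_iff_measure lmeasurable_open by blast
  then show ?thesis by (simp add: zero_less_measure_iff)
qed

lemma measure_Un_disjoint:
  assumes "A \<in> fmeasurable M" "B \<in> fmeasurable M" "A \<inter> B = {}"
  shows "measure M (A \<union> B) = measure M A + measure M B"
  using assms by (simp add: measure_Union fmeasurableD fmeasurableD2)

lemma measure_split_hyperplane:
  fixes S :: "'a::euclidean_space set"
  assumes S: "S \<in> lmeasurable" and k: "k \<in> Basis"
  shows "measure lebesgue S = measure lebesgue (S \<inter> {x. x \<bullet> k < c}) + measure lebesgue (S \<inter> {x. c < x \<bullet> k})"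
proof -
  have sets: "{x. x \<bullet> k < c} \<in> sets lebesgue" "{x. c < x \<bullet> k} \<in> sets lebesgue"
    by (auto simp: open_halfspace_component_lt open_halfspace_component_gt)
  let ?T = "S \<inter> {x. x \<bullet> k < c} \<union> S \<inter> {x. c < x \<bullet> k}"
  have "negligible {x. x \<bullet> k = c}" using k by (rule negligible_standard_hyperplane)
  then have neg: "negligible (S - ?T \<union> (?T - S))" by (rule negligible_subset) auto
  have "measure lebesgue S = measure lebesgue ?T"
    using measure_negligible_symdiff[OF S neg] by simp
  also have "\<dots> = measure lebesgue (S \<inter> {x. x \<bullet> k < c}) + measure lebesgue (S \<inter> {x. c < x \<bullet> k})"
    using fmeasurable_Int_fmeasurable[OF S] sets
    by (intro measure_Un_disjoint) auto
  finally show ?thesis .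
qed

text \<open>
  The part of \<open>S\<close> below height \<open>s\<close> grows continuously with \<open>s\<close> from 0 to everything: it is the
  distribution function of the push-forward of the volume on \<open>S\<close> under the height, and that
  measure has no atoms because hyperplanes are negligible. The claim is then the intermediate
  value theorem.
\<close>

lemma hyperplane_cut_proportion:
  fixes S :: "'a::euclidean_space set"
  assumes S: "S \<in> lmeasurable" and k: "k \<in> Basis" and \<theta>: "0 < \<theta>" "\<theta> < 1"
    and pos: "measure lebesgue S > 0"
  shows "\<exists>s. measure lebesgue (S \<inter> {x. x \<bullet> k < s}) = \<theta> * measure lebesgue S"
proof -
  define M where "M = distr (restrict_space lebesgue S) borel (\<lambda>x. x \<bullet> k)"
  have mk: "(\<lambda>x. x \<bullet> k) \<in> restrict_space lebesgue S \<rightarrow>\<^sub>M borel"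
    by (intro measurable_restrict_space1 measurable_completion) simp
  have Ssets: "S \<in> sets lebesgue" using S by auto
  have fin: "finite_measure (restrict_space lebesgue S)"
    using S Ssets by (intro finite_measureI) (auto simp: emeasure_restrict_space space_restrict_space fmeasurable_def)
  interpret M: finite_borel_measure M
    unfolding finite_borel_measure_def finite_borel_measure_axioms_def M_def
    using finite_measure.finite_measure_distr[OF fin mk] by simp
  have meas: "measure M X = measure lebesgue (S \<inter> {x. x \<bullet> k \<in> X})" if "X \<in> sets borel" for X
  proof -
    have "measure M X = measure (restrict_space lebesgue S) ((\<lambda>x. x \<bullet> k) -` X \<inter> space (restrict_space lebesgue S))"
      unfolding M_def using mk that by (rule measure_distr)
    also have "\<dots> = measure lebesgue ((\<lambda>x. x \<bullet> k) -` X \<inter> space (restrict_space lebesgue S))"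
      using Ssets by (intro measure_restrict_space) (auto simp: space_restrict_space)
    also have "(\<lambda>x. x \<bullet> k) -` X \<inter> space (restrict_space lebesgue S) = S \<inter> {x. x \<bullet> k \<in> X}"
      by (auto simp: space_restrict_space)
    finally show ?thesis .
  qed
  have hyper: "measure lebesgue (S \<inter> {x. x \<bullet> k = s}) = 0" for s
    using negligible_standard_hyperplane[OF k, of s]
    by (meson Int_lower2 negligible_imp_measure0 negligible_subset)
  have "isCont (cdf M) s" for s
    unfolding M.isCont_cdf using hyper[of s] by (simp add: meas)
  then have cont: "continuous_on UNIV (cdf M)" by (simp add: continuous_at_imp_continuous_on)
  have "space M = UNIV" by (simp add: M_def)
  then have total: "measure M (space M) = measure lebesgue S" using meas[of UNIV] by simp
  have "\<forall>\<^sub>F s in at_bot. cdf M s < \<theta> * measure lebesgue S"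
    using \<theta> pos by (intro order_tendstoD(2)[OF M.cdf_lim_at_bot]) simp
  then obtain u where u: "cdf M u < \<theta> * measure lebesgue S"
    by (auto simp: eventually_at_bot_linorder)
  have "\<forall>\<^sub>F s in at_top. cdf M s > \<theta> * measure lebesgue S"
    using \<theta> pos by (intro order_tendstoD(1)[OF M.cdf_lim_at_top]) (simp add: total)
  then obtain v where v: "cdf M v > \<theta> * measure lebesgue S"
    by (auto simp: eventually_at_top_linorder)
  have "u \<le> v"
    using u v M.cdf_nondecreasing[of v u] by linarith
  then obtain s where s: "cdf M s = \<theta> * measure lebesgue S"
    using IVT'[of "cdf M" u "\<theta> * measure lebesgue S" v] u v cont
    by (meson continuous_on_subset less_imp_le subset_UNIV)
  have "measure lebesgue (S \<inter> {x. x \<bullet> k < s}) = measure M {..<s}"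
    by (simp add: meas)
  also have "\<dots> = cdf M s"
  proof -
    have "cdf M s = measure M ({..<s} \<union> {s})"
      unfolding cdf_def by (rule arg_cong[of _ _ "measure M"]) auto
    also have "\<dots> = measure M {..<s} + measure M {s}"
      by (rule M.finite_measure_Union) auto
    finally show ?thesis using hyper[of s] by (simp add: meas)
  qed
  finally show ?thesis using s by auto
qed

text \<open>
  Nonempty disjoint boxes have disjoint projections to some axis. As the boxes are open, the separating
  hyperplane touches neither of them. Which box lies below is left undetermined.
\<close>

lemma disjoint_boxes_separated:
  fixes X Y :: "'a::euclidean_space set"
  assumes "X = box a b" "Y = box a' b'" "X \<noteq> {}" "Y \<noteq> {}" "X \<inter> Y = {}"
  obtains k c where "k \<in> Basis" "X \<subseteq> {x. x \<bullet> k < c} \<and> Y \<subseteq> {x. c < x \<bullet> k} \<or> Y \<subseteq> {x. x \<bullet> k < c} \<and> X \<subseteq> {x. c < x \<bullet> k}"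
proof -
  obtain k where k: "k \<in> Basis" "b \<bullet> k \<le> a' \<bullet> k \<or> b' \<bullet> k \<le> a \<bullet> k"
  proof -
    have "\<forall>i\<in>Basis. a \<bullet> i < b \<bullet> i" "\<forall>i\<in>Basis. a' \<bullet> i < b' \<bullet> i"
      using assms by (auto simp: box_eq_empty not_le)
    moreover have "box a b \<inter> box a' b' = {}" using assms by simp
    ultimately show ?thesis using that unfolding disjoint_interval by force
  qed
  show ?thesis
  proof (cases "b \<bullet> k \<le> a' \<bullet> k")
    case True
    then show ?thesis using k assms by (intro that[of k "b \<bullet> k"]) (force simp: mem_box)+
  next
    case False
    then show ?thesis using k assms by (intro that[of k "b' \<bullet> k"]) (force simp: mem_box)+
  qed
qed

text \<open>
  The step of the Hadwiger--Ohmann induction. A hyperplane that separates two boxes of \<open>\<A>\<close> leaves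
  fewer boxes of \<open>\<A>\<close> on either side. A parallel hyperplane cuts \<open>\<B>\<close> in the same proportion
  \<open>\<theta> : 1 - \<theta>\<close> of volume. The sum of the two lower parts and the sum of the two upper parts are
  separated by a third parallel hyperplane, so their volumes add up. Since the proportions agree,
  the induction hypothesis bounds the two volumes below by \<open>\<theta>\<close> and \<open>1 - \<theta>\<close> times the same number,
  the desired lower bound for the whole sum.
\<close>

lemma brunn_minkowski_box_packing_step:
  fixes \<A> \<B> :: "'a::euclidean_space set set"
  assumes A: "box_packing \<A>" and B: "box_packing \<B>" "\<B> \<noteq> {}" and card: "card \<A> \<ge> 2"
    and IH: "\<And>\<A>' \<B>' :: 'a set set. \<lbrakk>box_packing \<A>'; box_packing \<B>'; \<A>' \<noteq> {}; \<B>' \<noteq> {};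
        card \<A>' < card \<A>; card \<B>' \<le> card \<B>\<rbrakk> \<Longrightarrow> brunn_minkowski (\<Union>\<A>') (\<Union>\<B>')"
  shows "brunn_minkowski (\<Union>\<A>) (\<Union>\<B>)"
proof -
  let ?V = "measure (lebesgue :: 'a measure)" and ?n = "DIM('a)"
  let ?A = "\<Union>\<A>" and ?B = "\<Union>\<B>"
  have finA: "finite \<A>" and finB: "finite \<B>" using A B by (auto simp: box_packing_def)
  have box: "X \<noteq> {}" "\<exists>a b. X = box a b" if "X \<in> \<A>" for X
    using A that by (auto simp: box_packing_def)
  obtain X0 Y0 where XY0: "X0 \<in> \<A>" "Y0 \<in> \<A>" "X0 \<noteq> Y0"
    using card card_le_Suc0_iff_eq[OF finA] by fastforce
  have "X0 \<inter> Y0 = {}"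
    using A XY0 by (auto simp: box_packing_def pairwise_def disjnt_def)
  moreover obtain a b a' b' where "X0 = box a b" "Y0 = box a' b'" using box XY0 by blast
  ultimately obtain k c where k: "k \<in> Basis"
    and "X0 \<subseteq> {x. x \<bullet> k < c} \<and> Y0 \<subseteq> {x. c < x \<bullet> k} \<or> Y0 \<subseteq> {x. x \<bullet> k < c} \<and> X0 \<subseteq> {x. c < x \<bullet> k}"
    by (metis disjoint_boxes_separated box(1) XY0(1,2))
  then obtain X Y where XY: "X \<in> \<A>" "Y \<in> \<A>" "X \<noteq> {}" "Y \<noteq> {}"
    and c: "X \<subseteq> {x. x \<bullet> k < c}" "Y \<subseteq> {x. c < x \<bullet> k}"
    by (metis XY0(1,2) box(1))
  let ?L = "\<lambda>c. {x. x \<bullet> k < c}" and ?R = "\<lambda>c. {x. c < x \<bullet> k}"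
  note half = box_Int_halfspace[OF k]
  have oL: "open (?L t)" and oR: "open (?R t)" for t
    by (simp_all add: open_halfspace_component_lt open_halfspace_component_gt)
  have oA: "open ?A" "bounded ?A" and oB: "open ?B" "bounded ?B"
    using A B by (auto intro: box_packing_open box_packing_bounded)
  have B0: "?B \<noteq> {}" using B by (auto simp: box_packing_def)
  note lm = lmeasurable_open
  define \<theta> where "\<theta> = ?V (?A \<inter> ?L c) / ?V ?A"
  have "X \<subseteq> ?A \<inter> ?L c" "Y \<subseteq> ?A \<inter> ?R c" using XY c by auto
  then have neA: "?A \<inter> ?L c \<noteq> {}" "?A \<inter> ?R c \<noteq> {}" using XY(3,4) by blast+
  have "open (?A \<inter> ?L c)" "open (?A \<inter> ?R c)" "bounded (?A \<inter> ?L c)" "bounded (?A \<inter> ?R c)"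
    using oA oL oR by (simp_all add: open_Int bounded_Int)
  then have "?V (?A \<inter> ?L c) > 0" "?V (?A \<inter> ?R c) > 0"
    using neA measure_open_pos by blast+
  moreover have splitA: "?V ?A = ?V (?A \<inter> ?L c) + ?V (?A \<inter> ?R c)"
    using oA k by (intro measure_split_hyperplane lm)
  ultimately have \<theta>: "0 < \<theta>" "\<theta> < 1" and VA: "?V (?A \<inter> ?L c) = \<theta> * ?V ?A" "?V (?A \<inter> ?R c) = (1 - \<theta>) * ?V ?A"
    by (auto simp: \<theta>_def field_simps)
  have Bpos: "?V ?B > 0" using oB B0 by (intro measure_open_pos)
  obtain s where s: "?V (?B \<inter> ?L s) = \<theta> * ?V ?B"
    using hyperplane_cut_proportion[OF lm k \<theta> Bpos] oB by blast
  have splitB: "?V ?B = ?V (?B \<inter> ?L s) + ?V (?B \<inter> ?R s)"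
    using oB k by (intro measure_split_hyperplane lm)
  then have s': "?V (?B \<inter> ?R s) = (1 - \<theta>) * ?V ?B" using s by (simp add: algebra_simps)
  have "?V (?B \<inter> ?L s) \<noteq> 0" "?V (?B \<inter> ?R s) \<noteq> 0" using s s' \<theta> Bpos by auto
  then have neB: "?B \<inter> ?L s \<noteq> {}" "?B \<inter> ?R s \<noteq> {}" by auto
  have BM: "brunn_minkowski (?A \<inter> H) (?B \<inter> G)"
    if "\<And>a b. \<exists>u v. box a b \<inter> H = box u v" "\<And>a b. \<exists>u v. box a b \<inter> G = box u v"
      "?A \<inter> H \<noteq> {}" "?B \<inter> G \<noteq> {}" "Z \<in> \<A>" "Z \<inter> H = {}" for H G Z
    using IH[of "cut \<A> H" "cut \<B> G"] box_packing_cut[OF A that(1)] box_packing_cut[OF B(1) that(2)]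
      card_cut_less[OF finA that(5,6)] card_cut_le[OF finB, of G] that(3,4)
    by (metis Union_cut Union_empty)
  have BML: "brunn_minkowski (?A \<inter> ?L c) (?B \<inter> ?L s)"
    by (rule BM[OF half(1) half(1) neA(1) neB(1) XY(2)]) (use c(2) less_asym in blast)
  have BMR: "brunn_minkowski (?A \<inter> ?R c) (?B \<inter> ?R s)"
    by (rule BM[OF half(2) half(2) neA(2) neB(2) XY(1)]) (use c(1) less_asym in blast)
  let ?w = "root ?n (?V ?A) + root ?n (?V ?B)"
  have w: "?w \<ge> 0" by simp
  \<comment> \<open>The inequality is homogeneous, which is why equal proportions make the bounds add up.\<close>
  have part: "t * ?w ^ ?n \<le> ?V (S + T)"
    if "brunn_minkowski S T" "?V S = t * ?V ?A" "?V T = t * ?V ?B" "t > 0" for S T t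
  proof -
    have "root ?n t * ?w \<le> root ?n (?V (S + T))"
      using that(1) by (simp add: brunn_minkowski_def that(2,3) real_root_mult distrib_left)
    then have "(root ?n t * ?w) ^ ?n \<le> root ?n (?V (S + T)) ^ ?n"
      using w \<open>t > 0\<close> by (intro power_mono) auto
    then show ?thesis using \<open>t > 0\<close> by (simp add: power_mult_distrib)
  qed
  let ?SL = "?A \<inter> ?L c + ?B \<inter> ?L s" and ?SR = "?A \<inter> ?R c + ?B \<inter> ?R s"
  have oS: "open ?SL" "open ?SR" "bounded ?SL" "bounded ?SR" "open (?A + ?B)" "bounded (?A + ?B)"
    using oA oB oL oR by (auto intro!: open_set_plus bounded_set_plus)
  have "?w ^ ?n = \<theta> * ?w ^ ?n + (1 - \<theta>) * ?w ^ ?n" by (simp add: algebra_simps)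
  also have "\<dots> \<le> ?V ?SL + ?V ?SR"
    using part[OF BML VA(1) s] part[OF BMR VA(2) s'] \<theta> by (intro add_mono) auto
  also have "\<dots> = ?V (?SL \<union> ?SR)"
  proof (rule measure_Un_disjoint[symmetric])
    have "?SL \<subseteq> ?L (c + s)" "?SR \<subseteq> ?R (c + s)"
      by (auto simp: set_plus_def inner_add_left intro: add_strict_mono)
    then show "?SL \<inter> ?SR = {}" by force
  qed (use oS lm in auto)
  also have "\<dots> \<le> ?V (?A + ?B)"
    using oS by (intro measure_mono_fmeasurable lm fmeasurableD fmeasurable.Un) (auto simp: set_plus_def)
  finally have "root ?n (?w ^ ?n) \<le> root ?n (?V (?A + ?B))" by simp
  then show ?thesis using w by (simp add: brunn_minkowski_def real_root_power_cancel)
qed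

text \<open>
  Induction on the total number of boxes. The two packings play symmetric roles, so it is enough
  that one of them has two members; otherwise both are single boxes.
\<close>

lemma brunn_minkowski_box_packing:
  fixes \<A> \<B> :: "'a::euclidean_space set set"
  assumes "box_packing \<A>" "box_packing \<B>" "\<A> \<noteq> {}" "\<B> \<noteq> {}"
  shows "brunn_minkowski (\<Union>\<A>) (\<Union>\<B>)"
  using assms
proof (induction "card \<A> + card \<B>" arbitrary: \<A> \<B> rule: less_induct)
  case less
  consider "card \<A> \<ge> 2" | "card \<B> \<ge> 2" | "card \<A> = 1" "card \<B> = 1"
  proof -
    have "card \<A> > 0" "card \<B> > 0"
      using less.prems by (auto simp: box_packing_def card_gt_0_iff)
    then show ?thesis using that by linarith
  qed
  then show ?case
  proof cases
    case 1
    show ?thesis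
    proof (rule brunn_minkowski_box_packing_step)
      fix \<A>' \<B>' :: "'a set set"
      assume "box_packing \<A>'" "box_packing \<B>'" "\<A>' \<noteq> {}" "\<B>' \<noteq> {}"
        "card \<A>' < card \<A>" "card \<B>' \<le> card \<B>"
      then show "brunn_minkowski (\<Union>\<A>') (\<Union>\<B>')" by (intro less.hyps) auto
    qed (use less.prems 1 in auto)
  next
    case 2
    have "brunn_minkowski (\<Union>\<B>) (\<Union>\<A>)"
    proof (rule brunn_minkowski_box_packing_step)
      fix \<B>' \<A>' :: "'a set set"
      assume "box_packing \<B>'" "box_packing \<A>'" "\<B>' \<noteq> {}" "\<A>' \<noteq> {}"
        "card \<B>' < card \<B>" "card \<A>' \<le> card \<A>"
      then have "brunn_minkowski (\<Union>\<A>') (\<Union>\<B>')" by (intro less.hyps) auto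
      then show "brunn_minkowski (\<Union>\<B>') (\<Union>\<A>')" using brunn_minkowski_commute by blast
    qed (use less.prems 2 in auto)
    then show ?thesis using brunn_minkowski_commute by blast
  next
    case 3
    then obtain X Y where "\<A> = {X}" "\<B> = {Y}" by (metis card_1_singletonE)
    then show ?thesis
      using less.prems by (auto simp: box_packing_def intro!: brunn_minkowski_box)
  qed
qed

section \<open>The Brunn--Minkowski inequality for open and for convex sets\<close>

text \<open>
  An open set is a countable union of closed boxes, so finitely many of them fill it up to \<open>e\<close>.
  Their union can be divided into closed boxes with disjoint interiors, and passing to these
  interiors loses only faces.
\<close>

lemma open_box_packing_approx:
  fixes S :: "'a::euclidean_space set"
  assumes S: "open S" "bounded S" and e: "0 < e" 
  shows "\<exists>\<D>. box_packing \<D> \<and> \<Union>\<D> \<subseteq> S \<and> measure lebesgue S - e < measure lebesgue (\<Union>\<D>)"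
proof -
  obtain \<C> where C: "countable \<C>" "\<C> \<subseteq> Pow S" "\<And>X. X \<in> \<C> \<Longrightarrow> \<exists>a b. X = cbox a b" "\<Union>\<C> = S"
    using open_countable_Union_open_cbox[OF S(1)] by metis
  have Slm: "S \<in> lmeasurable" using S by (intro lmeasurable_open)
  obtain \<F> where F: "finite \<F>" "\<F> \<subseteq> \<C>" "measure lebesgue S - e < measure lebesgue (\<Union>\<F>)"
  proof (cases "\<C> = {}")
    case True
    then show ?thesis using C that[of "{}"] e by auto
  next
    case False
    define F where "F n = (\<Union>i\<le>n. from_nat_into \<C> i)" for n
    have box: "\<exists>a b. from_nat_into \<C> i = cbox a b" for i
      using C(3) from_nat_into[OF False] by blast
    have "range F \<subseteq> sets lebesgue"
    proof -
      have "from_nat_into \<C> i \<in> sets lebesgue" for i using box[of i] by auto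
      then show ?thesis unfolding F_def by auto
    qed
    moreover have "incseq F" by (force simp: F_def incseq_def)
    moreover have US: "(\<Union>n. F n) = S"
    proof -
      have "(\<Union>n. F n) = (\<Union>i. from_nat_into \<C> i)" by (auto simp: F_def)
      also have "\<dots> = \<Union>\<C>" using False C(1) by (simp add: range_from_nat_into)
      finally show ?thesis using C(4) by simp
    qed
    ultimately have "(\<lambda>n. measure lebesgue (F n)) \<longlonglongrightarrow> measure lebesgue S"
      using Lim_measure_incseq[of F lebesgue] fmeasurableD2[OF Slm]
      by (simp del: emeasure_completion measure_completion)
    then have "\<forall>\<^sub>F n in sequentially. measure lebesgue S - e < measure lebesgue (F n)"
      using e by (intro order_tendstoD(1)) auto
    then obtain n where "measure lebesgue S - e < measure lebesgue (F n)"
      by (auto simp: eventually_sequentially)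
    moreover have "from_nat_into \<C> ` {..n} \<subseteq> \<C>" using from_nat_into[OF False] by auto
    ultimately show ?thesis
      by (intro that[of "from_nat_into \<C> ` {..n}"]) (simp_all add: F_def)
  qed
  obtain p where p: "p division_of \<Union>\<F>"
    using elementary_unions_intervals[OF F(1)] F(2) C(3) by (metis subsetD)
  have pbox: "\<exists>a b. X = cbox a b" if "X \<in> p" for X using division_ofD(4)[OF p that] by blast
  have finp: "finite p" using p by (rule division_ofD(1))
  define \<D> where "\<D> = interior ` p - {{}}"
  have "box_packing \<D>"
    unfolding box_packing_def
  proof (intro conjI ballI)
    show "finite \<D>" using finp by (simp add: \<D>_def)
    show "pairwise disjnt \<D>"
      using division_ofD(5)[OF p] by (fastforce simp: \<D>_def pairwise_def disjnt_def)
    fix X assume "X \<in> \<D>"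
    then show "X \<noteq> {}" "\<exists>a b. X = box a b"
      using pbox by (auto simp: \<D>_def) (metis interior_cbox)
  qed
  moreover have UD: "\<Union>\<D> = (\<Union>X\<in>p. interior X)" by (auto simp: \<D>_def)
  moreover have Up: "(\<Union>X\<in>p. X) = \<Union>\<F>" using division_ofD(6)[OF p] by simp
  moreover have "(\<Union>X\<in>p. interior X) \<subseteq> (\<Union>X\<in>p. X)" using interior_subset by fast
  moreover have "\<Union>\<F> \<subseteq> S" using F(2) C(2) by auto
  moreover have "measure lebesgue (\<Union>\<F>) = measure lebesgue (\<Union>\<D>)"
  proof (rule measure_negligible_symdiff)
    have "negligible (\<Union>X\<in>p. X - interior X)"
    proof (rule negligible_Union)
      show "finite ((\<lambda>X. X - interior X) ` p)" using finp by simp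
      show "negligible Y" if "Y \<in> (\<lambda>X. X - interior X) ` p" for Y
        using that pbox negligible_frontier_interval by fastforce
    qed
    then show "negligible (\<Union>\<D> - \<Union>\<F> \<union> (\<Union>\<F> - \<Union>\<D>))"
      unfolding UD Up[symmetric] by (rule negligible_subset) (use \<open>(\<Union>X\<in>p. interior X) \<subseteq> (\<Union>X\<in>p. X)\<close> in blast)
    show "\<Union>\<D> \<in> lmeasurable"
      using \<open>box_packing \<D>\<close> by (intro lmeasurable_open box_packing_open box_packing_bounded)
  qed
  ultimately have "\<Union>\<D> \<subseteq> S" "measure lebesgue S - e < measure lebesgue (\<Union>\<D>)"
    using F(3) by auto
  then show ?thesis using \<open>box_packing \<D>\<close> by blast
qed

lemma brunn_minkowski_open:
  fixes A B :: "'a::euclidean_space set"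
  assumes A: "open A" "bounded A" "A \<noteq> {}" and B: "open B" "bounded B" "B \<noteq> {}"
  shows "brunn_minkowski A B"
proof -
  let ?V = "measure (lebesgue :: 'a measure)" and ?n = "DIM('a)"
  have pos: "?V A > 0" "?V B > 0" using A B by (auto intro!: measure_open_pos simp del: measure_completion)
  have AB: "A + B \<in> lmeasurable"
    using A B by (intro lmeasurable_open open_set_plus bounded_set_plus)
  have le: "root ?n (?V A - e) + root ?n (?V B - e) \<le> root ?n (?V (A + B))"
    if e: "0 < e" "e < ?V A" "e < ?V B" for e
  proof -
    obtain \<A> where \<A>: "box_packing \<A>" "\<Union>\<A> \<subseteq> A" "?V A - e < ?V (\<Union>\<A>)"
      using open_box_packing_approx[OF A(1,2) e(1)] by blast
    obtain \<B> where \<B>: "box_packing \<B>" "\<Union>\<B> \<subseteq> B" "?V B - e < ?V (\<Union>\<B>)"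
      using open_box_packing_approx[OF B(1,2) e(1)] by blast
    have "\<A> \<noteq> {}" "\<B> \<noteq> {}" using \<A>(3) \<B>(3) e by auto
    then have "brunn_minkowski (\<Union>\<A>) (\<Union>\<B>)"
      using \<A>(1) \<B>(1) by (intro brunn_minkowski_box_packing)
    then have "root ?n (?V (\<Union>\<A>)) + root ?n (?V (\<Union>\<B>)) \<le> root ?n (?V (\<Union>\<A> + \<Union>\<B>))"
      by (simp only: brunn_minkowski_def)
    moreover have "?V (\<Union>\<A> + \<Union>\<B>) \<le> ?V (A + B)"
      using \<A>(1,2) \<B>(1,2)
      by (intro measure_mono_fmeasurable[OF _ _ AB] set_plus_mono2 fmeasurableD lmeasurable_open
          open_set_plus bounded_set_plus box_packing_open box_packing_bounded)
    then have "root ?n (?V (\<Union>\<A> + \<Union>\<B>)) \<le> root ?n (?V (A + B))"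
      by (simp only: real_root_le_iff DIM_positive)
    moreover have "root ?n (?V A - e) \<le> root ?n (?V (\<Union>\<A>))" "root ?n (?V B - e) \<le> root ?n (?V (\<Union>\<B>))"
      using \<A>(3) \<B>(3) by (simp_all only: real_root_le_iff DIM_positive less_imp_le)
    ultimately show ?thesis by linarith
  qed
  have "((\<lambda>e. root ?n (?V A - e) + root ?n (?V B - e)) \<longlongrightarrow> root ?n (?V A - 0) + root ?n (?V B - 0)) (at_right 0)"
    by (intro tendsto_intros)
  moreover have "\<forall>\<^sub>F e in at_right 0. root ?n (?V A - e) + root ?n (?V B - e) \<le> root ?n (?V (A + B))"
    using pos le by (intro eventually_at_rightI[of 0 "min (?V A) (?V B)"]) (auto simp del: measure_completion)
  ultimately have "root ?n (?V A - 0) + root ?n (?V B - 0) \<le> root ?n (?V (A + B))"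
    by (intro tendsto_upperbound) auto
  then show ?thesis by (simp add: brunn_minkowski_def)
qed

text \<open>
  The boundary of a convex set is negligible, so the inequality passes from the interiors to the
  sets themselves. A summand without interior has volume 0, and then the sum still contains a
  translate of the other summand.
\<close>

theorem brunn_minkowski_convex:
  fixes A B :: "'a::euclidean_space set"
  assumes A: "convex A" "bounded A" "A \<noteq> {}" and B: "convex B" "bounded B" "B \<noteq> {}"
  shows "brunn_minkowski A B"
proof -
  let ?V = "measure (lebesgue :: 'a measure)" and ?n = "DIM('a)"
  have int: "?V (interior C) = ?V C" if "convex C" "bounded C" for C
    using that by (intro measure_interior negligible_convex_frontier)
  have degenerate: "brunn_minkowski A B"
    if A: "convex A" "bounded A" "A \<noteq> {}" "interior A = {}" and B: "convex B" "bounded B" for A B :: "'a set"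
  proof -
    obtain a where "a \<in> A" using A by blast
    have "?V B = ?V ((+) a ` B)" by (simp only: measure_translation)
    also have "\<dots> \<le> ?V (A + B)"
      using \<open>a \<in> A\<close> A B
      by (intro measure_mono_fmeasurable fmeasurableD measurable_convex convex_translation convex_set_plus
          bounded_translation bounded_set_plus) (auto simp: set_plus_def)
    finally have "root ?n (?V B) \<le> root ?n (?V (A + B))" by (simp only: real_root_le_iff DIM_positive)
    moreover have "?V A = 0" using int[OF A(1,2)] A(4) by simp
    ultimately show ?thesis by (simp add: brunn_minkowski_def)
  qed
  consider "interior A = {}" | "interior B = {}" | "interior A \<noteq> {}" "interior B \<noteq> {}" by blast
  then show ?thesis
  proof cases
    case 1
    then show ?thesis using degenerate A B by blast
  next
    case 2
    then have "brunn_minkowski B A" using degenerate A B by blast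
    then show ?thesis using brunn_minkowski_commute by blast
  next
    case 3
    then have "brunn_minkowski (interior A) (interior B)"
      using A B by (intro brunn_minkowski_open bounded_interior) auto
    moreover have "?V (interior A + interior B) \<le> ?V (A + B)"
      using A B
      by (intro measure_mono_fmeasurable set_plus_mono2 interior_subset fmeasurableD measurable_convex
          convex_set_plus convex_interior bounded_set_plus bounded_interior)
    then have "root ?n (?V (interior A + interior B)) \<le> root ?n (?V (A + B))"
      by (simp only: real_root_le_iff DIM_positive)
    ultimately show ?thesis
      using int A B by (simp only: brunn_minkowski_def)
  qed
qed

section \<open>Scaled bodies and the norm of a symmetric body\<close>

lemma measure_scaled:
  fixes S :: "'a::euclidean_space set"
  assumes "0 \<le> t"
  shows "measure lebesgue ((*\<^sub>R) t ` S) = t ^ DIM('a) * measure lebesgue S"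
  using measure_lebesgue_affine[of t 0 S] assms by simp

lemma root_volume_scaled:
  fixes S :: "'a::euclidean_space set"
  assumes "0 \<le> t" shows "root_volume ((*\<^sub>R) t ` S) = t * root_volume S"
  unfolding measure_scaled[OF assms] real_root_mult
  using assms by (simp add: real_root_power_cancel)

lemma measure_uminus:
  fixes S :: "'a::euclidean_space set"
  shows "measure lebesgue (uminus ` S) = measure lebesgue S"
  using measure_lebesgue_affine[of "-1" 0 S] by simp

lemma neighbourhood_K_eq_plus: "neighbourhood_K K r X = X + (*\<^sub>R) r ` K"
  by (auto simp: neighbourhood_K_def ball_K_def set_plus_def)

lemma convex_scaled_plus:
  fixes K :: "'a::real_vector set"
  assumes "convex K" "0 \<le> s" "0 \<le> t"
  shows "(*\<^sub>R) s ` K + (*\<^sub>R) t ` K \<subseteq> (*\<^sub>R) (s + t) ` K"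
proof
  fix z assume "z \<in> (*\<^sub>R) s ` K + (*\<^sub>R) t ` K"
  then obtain x y where xy: "x \<in> K" "y \<in> K" and z: "z = s *\<^sub>R x + t *\<^sub>R y"
    by (auto simp: set_plus_def)
  show "z \<in> (*\<^sub>R) (s + t) ` K"
  proof (cases "s + t = 0")
    case True
    then have "s = 0" "t = 0" using assms by auto
    then show ?thesis using xy z by auto
  next
    case False
    then have "(s / (s + t)) *\<^sub>R x + (t / (s + t)) *\<^sub>R y \<in> K"
      using assms xy by (intro convexD) (auto simp: add_divide_distrib[symmetric])
    moreover have "z = (s + t) *\<^sub>R ((s / (s + t)) *\<^sub>R x + (t / (s + t)) *\<^sub>R y)"
      using False by (simp add: z scaleR_add_right)
    ultimately show ?thesis by blast
  qed
qed

lemma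
  assumes "o_symmetric_convex_body K"
  shows body_compact: "compact K" and body_convex: "convex K" and body_bounded: "bounded K"
    and body_uminus: "x \<in> K \<Longrightarrow> - x \<in> K" and body_interior_ne: "interior K \<noteq> {}"
  using assms by (auto simp: o_symmetric_convex_body_def compact_imp_bounded)

lemma body_zero_interior:
  assumes K: "o_symmetric_convex_body K"
  shows "0 \<in> interior K"
proof -
  obtain x where x: "x \<in> interior K" using body_interior_ne[OF K] by blast
  then have "- x \<in> K" using interior_subset body_uminus[OF K] by blast
  then have "- x - (1/2) *\<^sub>R (- x - x) \<in> interior K"
    using mem_interior_convex_shrink[OF body_convex[OF K] x, of "-x" "1/2"] by simp
  moreover have "- x - (1/2) *\<^sub>R (- x - x) = 0"
    by (simp add: scaleR_diff_right flip: scaleR_add_left)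
  ultimately show ?thesis by simp
qed

text \<open>
  The least element that defines the norm exists because the factors \<open>t \<le> m\<close> with \<open>x \<in> t K\<close> form
  a nonempty compact set: they are the projection of a closed part of \<open>{0..m} \<times> K\<close>. The bound \<open>m\<close>
  comes from a ball about the origin inside \<open>K\<close>.
\<close>

lemma norm_K_attained:
  assumes K: "o_symmetric_convex_body K"
  shows "0 \<le> norm_K K x" "x \<in> (*\<^sub>R) (norm_K K x) ` K"
    and "\<And>t. \<lbrakk>0 \<le> t; x \<in> (*\<^sub>R) t ` K\<rbrakk> \<Longrightarrow> norm_K K x \<le> t"
proof -
  let ?P = "\<lambda>t. 0 \<le> t \<and> x \<in> (*\<^sub>R) t ` K"
  obtain e where e: "e > 0" "cball 0 e \<subseteq> K"
    using body_zero_interior[OF K] mem_interior_cball by blast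
  define m where "m = norm x / e"
  have "(e / norm x) *\<^sub>R x \<in> cball 0 e" using e by auto
  then have "?P m"
    using e by (cases "x = 0") (auto simp: m_def intro!: image_eqI[of _ _ "(e / norm x) *\<^sub>R x"])
  define G where "G = {0..m} \<times> K \<inter> (\<lambda>(t, y). t *\<^sub>R y) -` {x}"
  have "compact ({0..m} \<times> K)" using body_compact[OF K] by (intro compact_Times) auto
  moreover have "closed ((\<lambda>(t, y). t *\<^sub>R y) -` {x})"
    by (intro closed_vimage) (auto simp: case_prod_beta intro!: continuous_intros)
  ultimately have "compact G" unfolding G_def by (rule compact_Int_closed)
  then have "compact (fst ` G)" by (intro compact_continuous_image continuous_intros)
  moreover have mG: "m \<in> fst ` G" using \<open>?P m\<close> by (force simp: G_def)
  then have "fst ` G \<noteq> {}" by blast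
  ultimately obtain s where s: "s \<in> fst ` G" "\<And>t. t \<in> fst ` G \<Longrightarrow> s \<le> t"
    by (metis compact_attains_inf)
  have Ps: "?P s" using s(1) by (auto simp: G_def)
  have least: "s \<le> t" if "?P t" for t
  proof (cases "t \<le> m")
    case True
    with that have "t \<in> fst ` G" by (force simp: G_def)
    then show ?thesis by (rule s(2))
  next
    case False
    then show ?thesis using s(2)[OF mG] by linarith
  qed
  have "norm_K K x = s"
    unfolding norm_K_def by (rule Least_equality) (use Ps least in auto)
  then show "0 \<le> norm_K K x" "x \<in> (*\<^sub>R) (norm_K K x) ` K"
    and "\<And>t. \<lbrakk>0 \<le> t; x \<in> (*\<^sub>R) t ` K\<rbrakk> \<Longrightarrow> norm_K K x \<le> t"
    using Ps least by auto
qed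

lemma norm_K_uminus:
  assumes K: "o_symmetric_convex_body K"
  shows "norm_K K (- x) = norm_K K x"
proof -
  have "- x \<in> (*\<^sub>R) t ` K \<longleftrightarrow> x \<in> (*\<^sub>R) t ` K" for t
    using body_uminus[OF K] by (metis (no_types, lifting) image_iff minus_minus scaleR_minus_right)
  then show ?thesis by (simp add: norm_K_def)
qed

lemma norm_K_le_imp:
  assumes K: "o_symmetric_convex_body K" and x: "norm_K K x \<le> t"
  shows "x \<in> (*\<^sub>R) t ` K"
proof -
  have "0 \<in> K" using body_zero_interior[OF K] interior_subset by blast
  then have "{x} + {0} \<subseteq> (*\<^sub>R) (norm_K K x) ` K + (*\<^sub>R) (t - norm_K K x) ` K"
    using norm_K_attained(2)[OF K, of x] by (intro set_plus_mono2) force+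
  also have "\<dots> \<subseteq> (*\<^sub>R) t ` K"
    using convex_scaled_plus[OF body_convex[OF K], of "norm_K K x" "t - norm_K K x"]
      norm_K_attained(1)[OF K, of x] x by simp
  finally show ?thesis by (simp add: set_plus_def)
qed

text \<open>
  An interior point may be stretched by a factor \<open>1 + \<delta>\<close> without leaving \<open>K\<close>, so the infimum is
  strictly below the given factor. This is what makes interiors of separated balls disjoint.
\<close>

lemma norm_K_less_interior:
  assumes K: "o_symmetric_convex_body K" and x: "x \<in> interior K" and t: "0 < t"
  shows "norm_K K (t *\<^sub>R x) < t"
proof -
  obtain e where e: "e > 0" "cball x e \<subseteq> K" using x mem_interior_cball by blast
  define \<delta> where "\<delta> = e / (norm x + 1)"
  have n: "norm x + 1 > 0" by (simp add: add_nonneg_pos)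
  have \<delta>: "\<delta> > 0" using e n by (simp add: \<delta>_def)
  have "\<delta> * norm x \<le> \<delta> * (norm x + 1)" using \<delta> by (intro mult_left_mono) auto
  also have "\<dots> = e" using n by (simp add: \<delta>_def)
  finally have "(1 + \<delta>) *\<^sub>R x \<in> cball x e"
    using \<delta> by (simp add: dist_norm algebra_simps)
  then have "(1 + \<delta>) *\<^sub>R x \<in> K" using e by blast
  moreover have "t *\<^sub>R x = (t / (1 + \<delta>)) *\<^sub>R ((1 + \<delta>) *\<^sub>R x)" using \<delta> by simp
  ultimately have "t *\<^sub>R x \<in> (*\<^sub>R) (t / (1 + \<delta>)) ` K" by (rule rev_image_eqI)
  then have "norm_K K (t *\<^sub>R x) \<le> t / (1 + \<delta>)"
    using \<delta> t by (intro norm_K_attained(3)[OF K]) simp_all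
  also have "\<dots> < t" using \<delta> t by (simp add: divide_less_eq)
  finally show ?thesis .
qed

section \<open>The isodiametric inequality and the packing bound\<close>

text \<open>
  Among sets of given diameter, the ball is largest. Here the diameter of \<open>S\<close> is at most \<open>2 t\<close>,
  stated through the difference body \<open>S - S\<close>; as \<open>S\<close> and \<open>-S\<close> have the same volume,
  Brunn--Minkowski bounds twice the root of the volume of \<open>S\<close> by that of the difference body.
\<close>

theorem isodiametric_inequality:
  fixes S K :: "(real ^ 'n) set"
  assumes K: "o_symmetric_convex_body K" and S: "convex S" "bounded S" "S \<noteq> {}"
    and t: "0 \<le> t" and diam: "S + uminus ` S \<subseteq> (*\<^sub>R) (2 * t) ` K"
  shows "root_volume S \<le> t * root_volume K"
proof -
  have tK: "(*\<^sub>R) (2 * t) ` K \<in> lmeasurable"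
    using K by (intro measurable_convex convex_scaling bounded_scaling body_convex body_bounded)
  have S': "convex (uminus ` S)" "bounded (uminus ` S)" "uminus ` S \<noteq> {}"
    using S by (simp_all add: convex_negations)
  have "root_volume S + root_volume (uminus ` S) \<le> root_volume (S + uminus ` S)"
    using brunn_minkowski_convex[OF S S'] by (simp only: brunn_minkowski_def)
  also have "\<dots> \<le> root_volume ((*\<^sub>R) (2 * t) ` K)"
  proof -
    have "measure lebesgue (S + uminus ` S) \<le> measure lebesgue ((*\<^sub>R) (2 * t) ` K)"
      using S S' tK
      by (intro measure_mono_fmeasurable[OF diam _ tK] fmeasurableD measurable_convex convex_set_plus bounded_set_plus)
    then show ?thesis by (simp only: real_root_le_iff DIM_positive)
  qed
  also have "\<dots> = 2 * t * root_volume K" using t by (intro root_volume_scaled) simp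
  finally show ?thesis by (simp only: measure_uminus)
qed

text \<open>
  Balls of radius \<open>t\<close> around points at mutual distance at least \<open>2 t\<close> have disjoint interiors: a
  common point would make \<open>p i - p j\<close> equal to \<open>2 t\<close> times the midpoint of two interior points
  \<open>y\<close> and \<open>-x\<close> of \<open>K\<close>.
\<close>

lemma measure_separated_neighbourhood:
  fixes K :: "(real ^ 'n) set" and p :: "nat \<Rightarrow> real ^ 'n"
  assumes K: "o_symmetric_convex_body K" and t: "0 < t" and I: "finite I"
    and sep: "\<And>i j. \<lbrakk>i \<in> I; j \<in> I; i \<noteq> j\<rbrakk> \<Longrightarrow> 2 * t \<le> norm_K K (p i - p j)"
    and sub: "neighbourhood_K K t (p ` I) \<subseteq> C" and C: "C \<in> lmeasurable"
  shows "card I * (t ^ CARD('n) * measure lebesgue K) \<le> measure lebesgue C"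
proof -
  define U where "U i = (+) (p i) ` ((*\<^sub>R) t ` interior K)" for i
  have tK: "(*\<^sub>R) t ` interior K \<in> lmeasurable"
    using K by (intro measurable_convex convex_scaling bounded_scaling convex_interior bounded_interior body_convex body_bounded)
  have U: "U i \<in> lmeasurable" for i unfolding U_def using tK by (rule measurable_translation)
  have vol: "measure lebesgue (U i) = t ^ CARD('n) * measure lebesgue K" for i
  proof -
    have "measure lebesgue (U i) = measure lebesgue ((*\<^sub>R) t ` interior K)"
      unfolding U_def by (rule measure_translation)
    also have "\<dots> = t ^ CARD('n) * measure lebesgue (interior K)"
      using measure_scaled[of t "interior K"] t by simp
    also have "measure lebesgue (interior K) = measure lebesgue K"
      using K by (intro measure_interior negligible_convex_frontier body_convex body_bounded)
    finally show ?thesis .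
  qed
  have disj: "disjnt (U i) (U j)" if ij: "i \<in> I" "j \<in> I" "i \<noteq> j" for i j
  proof (rule ccontr)
    assume "\<not> disjnt (U i) (U j)"
    then obtain x y where xy: "x \<in> interior K" "y \<in> interior K" "p i + t *\<^sub>R x = p j + t *\<^sub>R y"
      by (auto simp: disjnt_def U_def)
    have "- x \<in> K" using xy(1) interior_subset body_uminus[OF K] by blast
    then have "- x - (1/2) *\<^sub>R (- x - y) \<in> interior K"
      using mem_interior_convex_shrink[OF body_convex[OF K] xy(2), of "- x" "1/2"] by simp
    moreover have "- x - (1/2) *\<^sub>R (- x - y) = (1/2) *\<^sub>R (y - x)"
    proof -
      have "x = (1/2) *\<^sub>R x + (1/2) *\<^sub>R x" by (simp flip: scaleR_add_left)
      then show ?thesis by (simp add: algebra_simps)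
    qed
    moreover have "p i - p j = (2 * t) *\<^sub>R ((1/2) *\<^sub>R (y - x))"
      using xy(3) by (simp add: algebra_simps)
    ultimately have "norm_K K (p i - p j) < 2 * t"
      using norm_K_less_interior[OF K, of "(1/2) *\<^sub>R (y - x)" "2 * t"] t
      by (simp only: zero_less_mult_iff zero_less_numeral simp_thms)
    then show False using sep[OF ij] by simp
  qed
  have "card I * (t ^ CARD('n) * measure lebesgue K) = (\<Sum>i\<in>I. measure lebesgue (U i))"
    by (simp only: vol sum_constant of_nat_id)
  also have "\<dots> = measure lebesgue (\<Union>i\<in>I. U i)"
    using I U disj by (intro measure_UNION'[symmetric]) (auto simp: pairwise_def)
  also have "\<dots> \<le> measure lebesgue C"
  proof (rule measure_mono_fmeasurable[OF _ _ C])
    show "(\<Union>i\<in>I. U i) \<subseteq> C"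
    proof (rule order_trans[OF _ sub])
      show "(\<Union>i\<in>I. U i) \<subseteq> neighbourhood_K K t (p ` I)"
        using interior_subset[of K] by (fastforce simp: U_def neighbourhood_K_def ball_K_def)
    qed
    show "(\<Union>i\<in>I. U i) \<in> sets lebesgue" using I U by (intro sets.finite_UN) auto
  qed
  finally show ?thesis .
qed

section \<open>Convex hulls of neighbourhoods under uniform contraction\<close>

theorem mainTheorem2:
  fixes K :: "(real ^ 'n) set"
    and r lam :: real
    and N :: nat
    and p q :: "nat \<Rightarrow> real ^ 'n"
  assumes "CARD('n) > 1"
    and "o_symmetric_convex_body K"
    and "r \<ge> lam / 2" and "lam / 2 > 0"
    and "N \<ge> 2 ^ CARD('n)"
    and "uniform_contraction K N lam q p"
  shows "measure lebesgue (convex hull (neighbourhood_K K r (q ` {1..N})))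
       \<le> measure lebesgue (convex hull (neighbourhood_K K r (p ` {1..N})))"
proof -
  note K = assms(2)
  let ?n = "CARD('n)" and ?V = "measure (lebesgue :: (real ^ 'n) measure)"
  let ?hull = "\<lambda>t f. convex hull (neighbourhood_K K t (f ` {1..N}))"
  have DIM: "DIM(real ^ 'n) = ?n" by simp
  have rpos: "r > 0" using assms by linarith
  have "(2::nat) ^ ?n > 0" by simp
  then have Npos: "N \<ge> 1" using assms(5) by linarith
  have K0: "0 \<in> K" using body_zero_interior[OF K] interior_subset by blast
  have cK: "convex ((*\<^sub>R) t ` K)" "bounded ((*\<^sub>R) t ` K)" "(*\<^sub>R) t ` K \<noteq> {}" for t
    using K K0 by (auto intro: convex_scaling bounded_scaling body_convex body_bounded)
  have hull: "convex (?hull t f)" "bounded (?hull t f)" "?hull t f \<noteq> {}" for t and f :: "nat \<Rightarrow> real ^ 'n"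
  proof -
    have "f 1 + t *\<^sub>R 0 \<in> neighbourhood_K K t (f ` {1..N})"
      unfolding neighbourhood_K_eq_plus using Npos K0 by (intro set_plus_intro imageI) simp_all
    then show "?hull t f \<noteq> {}" by auto
    show "bounded (?hull t f)"
      unfolding neighbourhood_K_eq_plus
      by (intro bounded_convex_hull bounded_set_plus cK(2) finite_imp_bounded) simp
  qed simp
  \<comment> \<open>Packing bound at radius \<open>lam / 2\<close>, then Brunn--Minkowski for the remaining radius
    \<open>r - lam / 2\<close>; the hypothesis \<open>N \<ge> 2 ^ d\<close> turns the root of \<open>N\<close> balls of radius
    \<open>lam / 2\<close> into at least that of one ball of radius \<open>lam\<close>.\<close>
  have lower: "(lam / 2 + r) * root_volume K \<le> root_volume (?hull r p)"
  proof -
    have "(2 * (lam / 2)) ^ ?n * ?V K = 2 ^ ?n * ((lam / 2) ^ ?n * ?V K)"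
      by (simp only: power_mult_distrib mult.assoc)
    also have "\<dots> \<le> N * ((lam / 2) ^ ?n * ?V K)"
    proof (rule mult_right_mono)
      show "(2::real) ^ ?n \<le> N" using assms(5) by (metis of_nat_le_iff of_nat_numeral of_nat_power)
      show "0 \<le> (lam / 2) ^ ?n * ?V K" using assms(4) by (intro mult_nonneg_nonneg zero_le_power measure_nonneg) simp
    qed
    also have "\<dots> = card {1..N} * ((lam / 2) ^ ?n * ?V K)" by simp
    also have "\<dots> \<le> ?V (?hull (lam / 2) p)"
    proof (rule measure_separated_neighbourhood[OF K assms(4)])
      fix i j assume ij: "i \<in> {1..N}" "j \<in> {1..N}" "i \<noteq> j"
      show "2 * (lam / 2) \<le> norm_K K (p i - p j)"
      proof (cases "i < j")
        case True
        then show ?thesis using assms(6) ij by (auto simp: uniform_contraction_def)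
      next
        case False
        then have "lam \<le> norm_K K (p j - p i)"
          using assms(6) ij by (auto simp: uniform_contraction_def)
        then show ?thesis using norm_K_uminus[OF K, of "p i - p j"] by simp
      qed
    next
      show "neighbourhood_K K (lam / 2) (p ` {1..N}) \<subseteq> ?hull (lam / 2) p" by (rule hull_subset)
      show "?hull (lam / 2) p \<in> lmeasurable" by (intro measurable_convex hull)
    qed simp
    finally have "root ?n ((2 * (lam / 2)) ^ ?n * ?V K) \<le> root ?n (?V (?hull (lam / 2) p))"
      by (simp only: real_root_le_iff zero_less_card_finite)
    moreover have "root ?n ((2 * (lam / 2)) ^ ?n * ?V K) = lam * root ?n (?V K)"
      unfolding real_root_mult using assms(4) by (simp add: real_root_power_cancel)
    ultimately have "lam * root ?n (?V K) \<le> root ?n (?V (?hull (lam / 2) p))" by (simp only:)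
    moreover have "0 \<le> r - lam / 2" using assms(3) by simp
    ultimately have "lam * root_volume K + (r - lam / 2) * root_volume K
        \<le> root_volume (?hull (lam / 2) p) + root_volume ((*\<^sub>R) (r - lam / 2) ` K)"
      by (simp only: root_volume_scaled) (simp only: DIM add_right_mono)
    also have "\<dots> \<le> root_volume (?hull (lam / 2) p + (*\<^sub>R) (r - lam / 2) ` K)"
      using brunn_minkowski_convex[OF hull cK] by (simp only: brunn_minkowski_def)
    also have "\<dots> \<le> root_volume (?hull r p)"
    proof -
      have "?hull (lam / 2) p + (*\<^sub>R) (r - lam / 2) ` K
          = convex hull (p ` {1..N} + ((*\<^sub>R) (lam / 2) ` K + (*\<^sub>R) (r - lam / 2) ` K))"
        using cK(1)[of "r - lam / 2"]
        by (simp only: neighbourhood_K_eq_plus convex_hull_set_plus hull_same add.assoc)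
      also have "\<dots> \<subseteq> ?hull r p"
        unfolding neighbourhood_K_eq_plus
        using convex_scaled_plus[OF body_convex[OF K], of "lam / 2" "r - lam / 2"] assms(3,4)
        by (intro hull_mono set_plus_mono2) auto
      finally have "?V (?hull (lam / 2) p + (*\<^sub>R) (r - lam / 2) ` K) \<le> ?V (?hull r p)"
        by (intro measure_mono_fmeasurable fmeasurableD measurable_convex convex_set_plus bounded_set_plus hull cK)
      then show ?thesis by (simp only: real_root_le_iff DIM_positive)
    qed
    finally show ?thesis by (simp add: algebra_simps)
  qed
  \<comment> \<open>The hull lies in a set of diameter \<open>lam + 2 r\<close>, since its difference body is the hull of
    \<open>(Q - Q) + (r K + r K)\<close>.\<close>
  have upper: "root_volume (?hull r q) \<le> (lam / 2 + r) * root_volume K"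
  proof (rule isodiametric_inequality[OF K hull])
    let ?Q = "q ` {1..N}" and ?R = "(*\<^sub>R) r ` K"
    have neg: "uminus ` (*\<^sub>R) t ` K = (*\<^sub>R) t ` K" for t
    proof -
      have "uminus ` K = K"
        using body_uminus[OF K] by (metis (no_types, lifting) image_eqI image_subsetI minus_minus subsetI subset_antisym)
      then show ?thesis by (metis (no_types, lifting) image_cong image_image scaleR_minus_right)
    qed
    have QQ: "?Q + uminus ` ?Q \<subseteq> (*\<^sub>R) lam ` K"
    proof -
      have "q i - q j \<in> (*\<^sub>R) lam ` K" if ij: "i \<in> {1..N}" "j \<in> {1..N}" for i j
      proof (cases i j rule: linorder_cases)
        case less
        then show ?thesis
          using assms(6) ij by (intro norm_K_le_imp[OF K]) (auto simp: uniform_contraction_def)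
      next
        case equal
        then show ?thesis using K0 by force
      next
        case greater
        then have "q j - q i \<in> (*\<^sub>R) lam ` K"
          using assms(6) ij by (intro norm_K_le_imp[OF K]) (auto simp: uniform_contraction_def)
        then have "- (q j - q i) \<in> uminus ` (*\<^sub>R) lam ` K" by (rule imageI)
        then show ?thesis by (simp only: neg minus_diff_eq)
      qed
      then show ?thesis by (auto simp: set_plus_def)
    qed
    have "?hull r q + uminus ` ?hull r q = convex hull ((?Q + ?R) + uminus ` (?Q + ?R))"
      unfolding neighbourhood_K_eq_plus convex_hull_linear_image[OF linear_uminus]
      by (rule convex_hull_set_plus[symmetric])
    also have "uminus ` (?Q + ?R) = uminus ` ?Q + uminus ` ?R"
      by (force simp: set_plus_def image_iff)
    also have "(?Q + ?R) + (uminus ` ?Q + uminus ` ?R) = (?Q + uminus ` ?Q) + (?R + ?R)"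
      by (simp only: neg ac_simps)
    also have "convex hull \<dots> \<subseteq> (*\<^sub>R) (2 * (lam / 2 + r)) ` K"
    proof (rule hull_minimal)
      have "(?Q + uminus ` ?Q) + (?R + ?R) \<subseteq> (*\<^sub>R) lam ` K + (*\<^sub>R) (r + r) ` K"
        using convex_scaled_plus[OF body_convex[OF K], of r r] rpos
        by (intro set_plus_mono2 QQ) simp
      also have "\<dots> \<subseteq> (*\<^sub>R) (lam + (r + r)) ` K"
        using assms(4) rpos by (intro convex_scaled_plus body_convex[OF K]) auto
      also have "lam + (r + r) = 2 * (lam / 2 + r)" by simp
      finally show "(?Q + uminus ` ?Q) + (?R + ?R) \<subseteq> (*\<^sub>R) (2 * (lam / 2 + r)) ` K" .
    qed (rule cK(1))
    finally show "?hull r q + uminus ` ?hull r q \<subseteq> (*\<^sub>R) (2 * (lam / 2 + r)) ` K" .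
    show "0 \<le> lam / 2 + r" using assms(4) rpos by simp
  qed
  have "root_volume (?hull r q) \<le> root_volume (?hull r p)" using upper lower by (rule order_trans)
  then show ?thesis by (simp only: real_root_le_iff DIM_positive)
qed

end
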